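(* Let $0<p<1$, $q=1-p$, and for $n\ge 0$ let $D_n$ denote the number of distinct adjacent two-letter patterns in a random word $\Gamma_1\Gamma_2\cdots\Gamma_n$ whose letters $\Gamma_1,\dots,\Gamma_n$ are i.i.d. with $\mathbb{P}(\Gamma_j=i)=pq^{i-1}$ for $i\ge 1$. Then, as formal power series in $z$, \[ \sum_{n\ge 0}\mathbb{E}[D_n]\,z^n=\sum_{i=1}^\infty \sum_{j \neq i} \left( \frac{1}{1-z}-\frac{1}{1-z+pq^{i-1}pq^{j-1}z^2}\right)+\sum_{i=1}^\infty \left( \frac{1}{1-z}-\frac{1}{1-z+\frac{pq^{i-1}pq^{i-1}z^2}{1+pq^{i-1}z}}\right),\] where the first sum is over all pairs of positive integers $i\neq j$.
   Context: A geometric random word of length $n$ is a sequence $\Gamma_1\cdots\Gamma_n$ of independent random variables with $\mathbb{P}(\Gamma_k=i)=pq^{i-1}$ for all positive integers $i$. An adjacent two-letter pattern (pair) occurring in the word is an ordered pair $(x,y)$ of positive integers such that $(\Gamma_k,\Gamma_{k+1})=(x,y)$ for some $1\le k\le n-1$; $D_n$ counts the distinct such ordered pairs (e.g. the word $12412413$ has the four distinct pairs $12,24,41,13$). *)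

theory Defs
  imports "HOL-Probability.Probability" "HOL-Computational_Algebra.Formal_Power_Series"
begin

text \<open>
  Letters are indexed from 1 and take values in the natural numbers. The point probabilities on the
  positive integers add up to 1, so the value 0 has probability 0.
\<close>

definition geometric_random_word :: "real \<Rightarrow> nat \<Rightarrow> 'a measure \<Rightarrow> (nat \<Rightarrow> 'a \<Rightarrow> nat) \<Rightarrow> bool" where
  "geometric_random_word p n M \<Gamma> \<longleftrightarrow>
     prob_space M \<and>
     prob_space.indep_vars M (\<lambda>_. count_space UNIV) \<Gamma> {1..n} \<and>
     (\<forall>k\<in>{1..n}. \<forall>i\<ge>1. measure M {\<omega> \<in> space M. \<Gamma> k \<omega> = i} = p * (1 - p) ^ (i - 1))"

definition adjacent_pairs :: "nat \<Rightarrow> (nat \<Rightarrow> 'b) \<Rightarrow> ('b \<times> 'b) set" where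
  "adjacent_pairs n w = {(x, y). \<exists>k. 1 \<le> k \<and> k + 1 \<le> n \<and> w k = x \<and> w (k + 1) = y}"

definition num_adjacent_pairs :: "nat \<Rightarrow> (nat \<Rightarrow> 'b) \<Rightarrow> nat" where
  "num_adjacent_pairs n w = card (adjacent_pairs n w)"

text \<open>
  Infinite sums of real formal power series converge coefficient by coefficient, in the usual
  topology of the reals. The library's metric on formal power series is the one with discrete
  coefficients, in which the sums considered here do not converge.
\<close>

definition fps_has_sum :: "('i \<Rightarrow> real fps) \<Rightarrow> real fps \<Rightarrow> 'i set \<Rightarrow> bool" where
  "fps_has_sum F S A \<longleftrightarrow> (\<forall>n. ((\<lambda>i. fps_nth (F i) n) has_sum fps_nth S n) A)"

end

theory Submission
  imports Defs
begin

text \<open>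
  By Tonelli, the expected number of pairs is the sum over all pairs of the probability that the
  pair occurs. Write \<open>a\<close> and \<open>b\<close> for the probabilities of the letters \<open>x\<close> and \<open>y\<close>, \<open>u\<^sub>m\<close> for the
  probability that \<open>xy\<close> does not occur among the first \<open>m\<close> letters, and \<open>c\<^sub>m\<close> for the probability
  that in addition the \<open>m\<close>-th letter is \<open>x\<close>. Then \<open>u\<^sub>m\<^sub>+\<^sub>2 = u\<^sub>m\<^sub>+\<^sub>1 - b c\<^sub>m\<^sub>+\<^sub>1\<close>, where
  \<open>c\<^sub>m\<^sub>+\<^sub>1 = a u\<^sub>m\<close> if \<open>x \<noteq> y\<close> and \<open>c\<^sub>m\<^sub>+\<^sub>1 = a (u\<^sub>m - c\<^sub>m)\<close> if \<open>x = y\<close>. These are the recurrences of the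
  coefficients of the two rational functions.
\<close>

unbundle no vec_syntax and fps_syntax

section \<open>Occurrence of pairs in a word, and properties fixed by a prefix\<close>

lemma mem_adjacent_pairs:
  "(x, y) \<in> adjacent_pairs n w \<longleftrightarrow> (\<exists>k. 1 \<le> k \<and> k + 1 \<le> n \<and> w k = x \<and> w (k + 1) = y)"
  by (simp add: adjacent_pairs_def)

text \<open>A new letter adds one position at which a pair can occur, provided that the word was
  nonempty; hence the start at length 2.\<close>

lemma mem_adjacent_pairs_Suc_Suc:
  "(x, y) \<in> adjacent_pairs (Suc (Suc n)) w \<longleftrightarrow>
     (x, y) \<in> adjacent_pairs (Suc n) w \<or> w (Suc n) = x \<and> w (Suc (Suc n)) = y"
  by (auto simp: mem_adjacent_pairs le_Suc_eq)

lemma adjacent_pairs_less_2 [simp]: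
  "adjacent_pairs 0 w = {}" "adjacent_pairs (Suc 0) w = {}"
  by (auto simp: adjacent_pairs_def)

lemma adjacent_pairs_cong:
  assumes "\<And>i. i \<in> {1..n} \<Longrightarrow> v i = w i"
  shows "adjacent_pairs n v = adjacent_pairs n w"
  using assms by (auto simp: adjacent_pairs_def)

text \<open>Words are total functions. This condition allows a property of the word to be moved to
  the restriction to \<open>{1..m}\<close>, a random element of a finite product.\<close>

definition determined_by_prefix :: "nat \<Rightarrow> ((nat \<Rightarrow> 'b) \<Rightarrow> bool) \<Rightarrow> bool" where
  "determined_by_prefix m P \<longleftrightarrow> (\<forall>v w. (\<forall>i\<in>{1..m}. v i = w i) \<longrightarrow> P v = P w)"

lemma determined_by_prefix_letter: "k \<in> {1..m} \<Longrightarrow> determined_by_prefix m (\<lambda>w. w k = x)"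
  by (auto simp: determined_by_prefix_def)

text \<open>The free \<open>Q\<close> serves both for membership of a pair and for the number of
  pairs.\<close>

lemma determined_by_prefix_adjacent_pairs:
  "k \<le> m \<Longrightarrow> determined_by_prefix m (\<lambda>w. Q (adjacent_pairs k w))"
  unfolding determined_by_prefix_def
proof (intro allI impI)
  fix v w :: "nat \<Rightarrow> 'a"
  assume "k \<le> m" "\<forall>i\<in>{1..m}. v i = w i"
  then have "adjacent_pairs k v = adjacent_pairs k w"
    by (intro adjacent_pairs_cong) auto
  then show "Q (adjacent_pairs k v) = Q (adjacent_pairs k w)"
    by simp
qed

lemma determined_by_prefix_not:
  "determined_by_prefix m P \<Longrightarrow> determined_by_prefix m (\<lambda>w. \<not> P w)"
  unfolding determined_by_prefix_def by blast

lemma determined_by_prefix_conj: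
  "determined_by_prefix m P \<Longrightarrow> determined_by_prefix m Q \<Longrightarrow> determined_by_prefix m (\<lambda>w. P w \<and> Q w)"
  unfolding determined_by_prefix_def by blast

lemmas determined_by_prefix_intros =
  determined_by_prefix_letter determined_by_prefix_adjacent_pairs
  determined_by_prefix_not determined_by_prefix_conj

lemma adjacent_pairs_image:
  "adjacent_pairs n w = (\<lambda>k. (w k, w (k + 1))) ` {1..<n}"
  by (force simp: adjacent_pairs_def)

lemma finite_adjacent_pairs [simp]: "finite (adjacent_pairs n w)"
  by (simp add: adjacent_pairs_image)

lemma num_adjacent_pairs_le: "num_adjacent_pairs n w \<le> n"
proof -
  have "num_adjacent_pairs n w \<le> card {1..<n}"
    unfolding num_adjacent_pairs_def adjacent_pairs_image by (rule card_image_le) simp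
  then show ?thesis by simp
qed

section \<open>Prefix events and independence of the next letter\<close>

locale random_word = prob_space M for M :: "'a measure" +
  fixes n :: nat and X :: "nat \<Rightarrow> 'a \<Rightarrow> 'b :: countable"
  assumes indep: "indep_vars (\<lambda>_. count_space UNIV) X {1..n}"
begin

text \<open>Countably many letters make the finite product discrete, so every set of prefixes is
  measurable.\<close>

lemma PiM_letters:
  "finite A \<Longrightarrow> PiM A (\<lambda>_. count_space (UNIV :: 'b set)) = count_space (PiE A (\<lambda>_. UNIV))"
  by (rule count_space_PiM_finite) auto

lemma measurable_letter [measurable]:
  "k \<in> {1..n} \<Longrightarrow> X k \<in> M \<rightarrow>\<^sub>M count_space UNIV"
  using indep by (auto simp: indep_vars_def)

lemma prefix_event:
  assumes "determined_by_prefix m P"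
  shows "{\<omega> \<in> space M. P (\<lambda>k. X k \<omega>)} =
    (\<lambda>\<omega>. restrict (\<lambda>k. X k \<omega>) {1..m}) -` {w \<in> PiE {1..m} (\<lambda>_. UNIV). P w} \<inter> space M"
proof -
  have "P (\<lambda>k. X k \<omega>) = P (restrict (\<lambda>k. X k \<omega>) {1..m})" for \<omega>
    using assms by (simp add: determined_by_prefix_def)
  then show ?thesis by auto
qed

lemma sets_prefix_event:
  assumes "determined_by_prefix m P" and "m \<le> n"
  shows "{\<omega> \<in> space M. P (\<lambda>k. X k \<omega>)} \<in> events"
proof -
  have "(\<lambda>\<omega>. restrict (\<lambda>k. X k \<omega>) {1..m}) \<in> M \<rightarrow>\<^sub>M PiM {1..m} (\<lambda>_. count_space UNIV)"
    using \<open>m \<le> n\<close> by (intro measurable_restrict) auto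
  then show ?thesis
    unfolding prefix_event[OF assms(1)] by (rule measurable_sets) (auto simp: PiM_letters)
qed

text \<open>The index sets \<open>{1..m}\<close> and \<open>{Suc m}\<close> are disjoint, so the
  restrictions of \<open>X\<close> to them are independent; each event is a preimage under one
  restriction.\<close>

lemma prob_prefix_letter:
  assumes P: "determined_by_prefix m P" and "m < n"
  shows "prob {\<omega> \<in> space M. P (\<lambda>k. X k \<omega>) \<and> X (Suc m) \<omega> = y} =
    prob {\<omega> \<in> space M. P (\<lambda>k. X k \<omega>)} * prob {\<omega> \<in> space M. X (Suc m) \<omega> = y}"
proof -
  let ?A = "{w \<in> PiE {1..m} (\<lambda>_. UNIV). P w}"
  let ?B = "{w \<in> PiE {Suc m} (\<lambda>_. UNIV). w (Suc m) = y}"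
  let ?f = "\<lambda>\<omega>. restrict (\<lambda>k. X k \<omega>) {1..m}" and ?g = "\<lambda>\<omega>. restrict (\<lambda>k. X k \<omega>) {Suc m}"
  have "indep_var (PiM {1..m} (\<lambda>_. count_space UNIV)) ?f (PiM {Suc m} (\<lambda>_. count_space UNIV)) ?g"
    using \<open>m < n\<close> by (intro indep_var_restrict[OF indep]) auto
  from indep_varD[OF this, of ?A ?B]
  have *: "prob ((\<lambda>\<omega>. (?f \<omega>, ?g \<omega>)) -` (?A \<times> ?B) \<inter> space M) =
    prob (?f -` ?A \<inter> space M) * prob (?g -` ?B \<inter> space M)"
    by (simp add: PiM_letters)
  have g: "?g -` ?B \<inter> space M = {\<omega> \<in> space M. X (Suc m) \<omega> = y}"
    by auto
  have "(\<lambda>\<omega>. (?f \<omega>, ?g \<omega>)) -` (?A \<times> ?B) \<inter> space M =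
      (?f -` ?A \<inter> space M) \<inter> (?g -` ?B \<inter> space M)"
    by blast
  also have "\<dots> = {\<omega> \<in> space M. P (\<lambda>k. X k \<omega>) \<and> X (Suc m) \<omega> = y}"
    unfolding g prefix_event[OF P, symmetric] by blast
  finally show ?thesis
    using * by (simp only: g prefix_event[OF P, symmetric])
qed

lemma sets_letter [measurable]:
  "k \<in> {1..n} \<Longrightarrow> {\<omega> \<in> space M. X k \<omega> = y} \<in> events"
  by (rule sets_prefix_event[OF determined_by_prefix_letter order_refl])

section \<open>Recurrences for the avoidance probabilities\<close>

definition avoid :: "'b \<Rightarrow> 'b \<Rightarrow> nat \<Rightarrow> real" where
  "avoid x y m = prob {\<omega> \<in> space M. (x, y) \<notin> adjacent_pairs m (\<lambda>k. X k \<omega>)}"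

text \<open>This is \<open>c\<^sub>m\<close>. It is meant for positive \<open>m\<close> only: at
  \<open>m = 0\<close> it refers to \<open>X 0\<close>, which is not a letter of the word.\<close>

definition avoid_end :: "'b \<Rightarrow> 'b \<Rightarrow> nat \<Rightarrow> real" where
  "avoid_end x y m =
     prob {\<omega> \<in> space M. (x, y) \<notin> adjacent_pairs m (\<lambda>k. X k \<omega>) \<and> X m \<omega> = x}"

lemma sets_avoid:
  "m \<le> n \<Longrightarrow> {\<omega> \<in> space M. (x, y) \<notin> adjacent_pairs m (\<lambda>k. X k \<omega>)} \<in> events"
  by (intro sets_prefix_event[of m] determined_by_prefix_intros) auto

lemma sets_avoid_end:
  assumes "1 \<le> m" "m \<le> n"
  shows "{\<omega> \<in> space M. (x, y) \<notin> adjacent_pairs m (\<lambda>k. X k \<omega>) \<and> X m \<omega> = z} \<in> events"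
  using assms
  by (intro sets_prefix_event[where P = "\<lambda>w. (x, y) \<notin> adjacent_pairs m w \<and> w m = z" and m = m]
        determined_by_prefix_intros) auto

lemma avoid_less_2: "avoid x y 0 = 1" "avoid x y (Suc 0) = 1"
  by (simp_all add: avoid_def prob_space)

text \<open>Avoidance is lost at the new letter exactly on \<open>?C\<close>: the prefix avoids the
  pair and ends in \<open>x\<close>, and then \<open>y\<close> follows. Independence factors the
  probability of \<open>?C\<close>.\<close>

lemma avoid_Suc_Suc:
  assumes "Suc (Suc m) \<le> n"
  shows "avoid x y (Suc (Suc m)) =
    avoid x y (Suc m) - avoid_end x y (Suc m) * prob {\<omega> \<in> space M. X (Suc (Suc m)) \<omega> = y}"
proof -
  let ?N = "{\<omega> \<in> space M. (x, y) \<notin> adjacent_pairs (Suc m) (\<lambda>k. X k \<omega>)}"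
  let ?P = "\<lambda>w. (x, y) \<notin> adjacent_pairs (Suc m) w \<and> w (Suc m) = x"
  let ?C = "{\<omega> \<in> space M. ?P (\<lambda>k. X k \<omega>) \<and> X (Suc (Suc m)) \<omega> = y}"
  have "?C = {\<omega> \<in> space M. ?P (\<lambda>k. X k \<omega>)} \<inter> {\<omega> \<in> space M. X (Suc (Suc m)) \<omega> = y}"
    by blast
  also have "\<dots> \<in> events"
    using assms by (intro sets.Int sets_avoid_end sets_letter) auto
  finally have C: "?C \<in> events" .
  have "avoid x y (Suc (Suc m)) = prob (?N - ?C)"
    unfolding avoid_def by (rule arg_cong[where f = prob]) (auto simp: mem_adjacent_pairs_Suc_Suc)
  also have "\<dots> = prob ?N - prob ?C"
    using assms by (intro finite_measure_Diff sets_avoid C) auto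
  also have "prob ?C = avoid_end x y (Suc m) * prob {\<omega> \<in> space M. X (Suc (Suc m)) \<omega> = y}"
    unfolding avoid_end_def using assms
    by (intro prob_prefix_letter[where P = ?P] determined_by_prefix_intros) auto
  finally show ?thesis by (simp add: avoid_def)
qed

text \<open>A final \<open>x\<close> cannot complete the pair when \<open>y\<close> is another
  letter, so avoidance only constrains the first \<open>m\<close> letters.\<close>

lemma avoid_end_distinct:
  assumes "x \<noteq> y" "Suc m \<le> n"
  shows "avoid_end x y (Suc m) = avoid x y m * prob {\<omega> \<in> space M. X (Suc m) \<omega> = x}"
proof -
  have "avoid_end x y (Suc m) =
    prob {\<omega> \<in> space M. (x, y) \<notin> adjacent_pairs m (\<lambda>k. X k \<omega>) \<and> X (Suc m) \<omega> = x}"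
    unfolding avoid_end_def using \<open>x \<noteq> y\<close>
    by (cases m) (auto simp: mem_adjacent_pairs_Suc_Suc intro!: arg_cong[where f = prob])
  also have "\<dots> = avoid x y m * prob {\<omega> \<in> space M. X (Suc m) \<omega> = x}"
    unfolding avoid_def using assms
    by (intro prob_prefix_letter determined_by_prefix_intros) auto
  finally show ?thesis .
qed

lemma avoid_end_one: "avoid_end x y (Suc 0) = prob {\<omega> \<in> space M. X (Suc 0) \<omega> = x}"
  by (simp add: avoid_end_def)

text \<open>A final \<open>x\<close> completes the pair exactly when the letter before it is
  \<open>x\<close>; the prefix must avoid the pair and end in another letter.\<close>

lemma avoid_end_same:
  assumes "Suc (Suc m) \<le> n"
  shows "avoid_end x x (Suc (Suc m)) =
    (avoid x x (Suc m) - avoid_end x x (Suc m)) * prob {\<omega> \<in> space M. X (Suc (Suc m)) \<omega> = x}"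
proof -
  let ?P = "\<lambda>w. (x, x) \<notin> adjacent_pairs (Suc m) w \<and> w (Suc m) \<noteq> x"
  have "avoid_end x x (Suc (Suc m)) =
    prob {\<omega> \<in> space M. ?P (\<lambda>k. X k \<omega>) \<and> X (Suc (Suc m)) \<omega> = x}"
    unfolding avoid_end_def
    by (rule arg_cong[where f = prob]) (auto simp: mem_adjacent_pairs_Suc_Suc)
  also have "\<dots> = prob {\<omega> \<in> space M. ?P (\<lambda>k. X k \<omega>)} * prob {\<omega> \<in> space M. X (Suc (Suc m)) \<omega> = x}"
    using assms by (intro prob_prefix_letter[where P = ?P] determined_by_prefix_intros) auto
  also have "{\<omega> \<in> space M. ?P (\<lambda>k. X k \<omega>)} =
      {\<omega> \<in> space M. (x, x) \<notin> adjacent_pairs (Suc m) (\<lambda>k. X k \<omega>)} -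
      {\<omega> \<in> space M. (x, x) \<notin> adjacent_pairs (Suc m) (\<lambda>k. X k \<omega>) \<and> X (Suc m) \<omega> = x}"
    by blast
  also have "prob \<dots> = avoid x x (Suc m) - avoid_end x x (Suc m)"
    unfolding avoid_def avoid_end_def using assms
    by (intro finite_measure_Diff sets_avoid sets_avoid_end) auto
  finally show ?thesis .
qed

section \<open>The expectation as a sum of occurrence probabilities\<close>

lemma prob_adjacent_pairs:
  "prob {\<omega> \<in> space M. (x, y) \<in> adjacent_pairs n (\<lambda>k. X k \<omega>)} = 1 - avoid x y n"
proof -
  have "{\<omega> \<in> space M. (x, y) \<in> adjacent_pairs n (\<lambda>k. X k \<omega>)} =
      space M - {\<omega> \<in> space M. (x, y) \<notin> adjacent_pairs n (\<lambda>k. X k \<omega>)}"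
    by blast
  then show ?thesis
    by (simp add: prob_compl sets_avoid avoid_def)
qed

lemma expectation_num_adjacent_pairs:
  "((\<lambda>(x, y). prob {\<omega> \<in> space M. (x, y) \<in> adjacent_pairs n (\<lambda>k. X k \<omega>)})
     has_sum expectation (\<lambda>\<omega>. real (num_adjacent_pairs n (\<lambda>k. X k \<omega>)))) UNIV"
proof -
  let ?E = "\<lambda>z. {\<omega> \<in> space M. z \<in> adjacent_pairs n (\<lambda>k. X k \<omega>)}"
  let ?D = "\<lambda>\<omega>. real (num_adjacent_pairs n (\<lambda>k. X k \<omega>))"
  have E: "?E z \<in> events" for z
    by (intro sets_prefix_event[of n] determined_by_prefix_intros) auto
  \<comment> \<open>The size of the finite set of pairs is the integral of its indicator against
    counting measure.\<close>
  have D: "ennreal (?D \<omega>) = (\<integral>\<^sup>+z. indicator (?E z) \<omega> \<partial>count_space UNIV)"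
    if "\<omega> \<in> space M" for \<omega>
  proof -
    have "(\<integral>\<^sup>+z. indicator (?E z) \<omega> \<partial>count_space UNIV) =
        (\<integral>\<^sup>+z. indicator (adjacent_pairs n (\<lambda>k. X k \<omega>)) z \<partial>count_space UNIV)"
      using that by (intro nn_integral_cong) (auto simp: indicator_def)
    also have "\<dots> = ennreal (?D \<omega>)"
      by (simp add: num_adjacent_pairs_def ennreal_of_nat_eq_real_of_nat)
    finally show ?thesis by simp
  qed
  have "{\<omega> \<in> space M. num_adjacent_pairs n (\<lambda>k. X k \<omega>) = j} \<in> events" for j
    unfolding num_adjacent_pairs_def
    by (intro sets_prefix_event[of n] determined_by_prefix_intros) auto
  then have [measurable]: "(\<lambda>\<omega>. num_adjacent_pairs n (\<lambda>k. X k \<omega>)) \<in> M \<rightarrow>\<^sub>M count_space UNIV"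
    by (auto simp: measurable_count_space_eq2_countable vimage_def Int_def conj_commute)
  \<comment> \<open>The count is bounded by \<open>n\<close>, which makes it integrable.\<close>
  have int: "integrable M ?D"
    by (rule integrable_const_bound[of _ "real n"]) (auto simp: num_adjacent_pairs_le)
  have "ennreal (expectation ?D) = (\<integral>\<^sup>+\<omega>. ennreal (?D \<omega>) \<partial>M)"
    using int by (simp add: nn_integral_eq_integral)
  also have "\<dots> = (\<integral>\<^sup>+\<omega>. \<integral>\<^sup>+z. indicator (?E z) \<omega> \<partial>count_space UNIV \<partial>M)"
    by (intro nn_integral_cong D)
  also have "\<dots> = (\<integral>\<^sup>+z. \<integral>\<^sup>+\<omega>. indicator (?E z) \<omega> \<partial>M \<partial>count_space UNIV)"
    using E by (intro nn_integral_count_space_nn_integral) auto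
  also have "\<dots> = (\<integral>\<^sup>+z. ennreal (prob (?E z)) \<partial>count_space UNIV)"
    using E by (simp add: emeasure_eq_measure)
  finally have "has_bochner_integral (count_space UNIV) (\<lambda>z. prob (?E z)) (expectation ?D)"
    by (intro has_bochner_integral_nn_integral) auto
  \<comment> \<open>An integral over \<open>count_space\<close> is an \<open>infsetsum\<close>;
    absolute summability turns it into \<open>has_sum\<close>.\<close>
  then have abs: "Infinite_Set_Sum.abs_summable_on (\<lambda>z. prob (?E z)) UNIV"
    and eq: "infsetsum (\<lambda>z. prob (?E z)) UNIV = expectation ?D"
    by (auto simp: has_bochner_integral_iff Infinite_Set_Sum.abs_summable_on_def infsetsum_def)
  have "(\<lambda>z. prob (?E z)) summable_on UNIV"
    using abs by (rule abs_summable_summable[OF abs_summable_equivalent[THEN iffD2]])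
  then have "((\<lambda>z. prob (?E z)) has_sum expectation ?D) UNIV"
    unfolding eq[symmetric] infsetsum_infsum[OF abs] by (rule has_sum_infsum)
  then show ?thesis
    by (simp add: case_prod_unfold)
qed

end

section \<open>Coefficients of the rational series\<close>

lemma fps_nth_inverse_quadratic:
  fixes c :: "'a :: field"
  defines "U \<equiv> 1 / (1 - fps_X + fps_const c * fps_X ^ 2)"
  shows "U $ 0 = 1" "U $ 1 = 1" "U $ (m + 2) = U $ (m + 1) - c * U $ m"
proof -
  have "U * (1 - fps_X + fps_const c * fps_X ^ 2) = 1"
    unfolding U_def by (subst fps_divide_unit) (simp_all add: inverse_mult_eq_1)
  \<comment> \<open>In this fixed-point form each coefficient is given by earlier ones, so one
    unfolding yields the recurrence.\<close>
  then have U: "U = 1 + fps_X * U - fps_const c * (fps_X ^ 2 * U)"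
    by (simp add: algebra_simps)
  show "U $ 0 = 1" by (subst U) simp
  then show "U $ 1 = 1" by (subst U) (simp add: fps_X_power_mult_nth)
  show "U $ (m + 2) = U $ (m + 1) - c * U $ m"
    by (subst U) (simp add: fps_X_power_mult_nth)
qed

text \<open>Multiplying the denominator by \<open>V = 1 + r X\<close> clears the inner fraction and
  leaves \<open>1 - (1 - r) X - (r - r * r) X^2\<close>. The numerator \<open>V\<close> affects only
  the first two steps, so the recurrence holds from index 2 on.\<close>

lemma fps_nth_inverse_diagonal:
  fixes r :: "'a :: field"
  defines "U \<equiv> 1 / (1 - fps_X + fps_const (r * r) * fps_X ^ 2 / (1 + fps_const r * fps_X))"
  shows "U $ 0 = 1" "U $ 1 = 1" "U $ (m + 2) = (1 - r) * U $ (m + 1) + (r - r * r) * U $ m"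
proof -
  define V W where "V = 1 + fps_const r * fps_X"
    and "W = 1 - fps_X + fps_const (r * r) * fps_X ^ 2 * inverse V"
  have V: "V * inverse V = 1"
    by (simp add: V_def inverse_mult_eq_1')
  have "U = inverse W"
    unfolding U_def W_def V_def by (subst (1 2) fps_divide_unit) simp_all
  then have "U * W = 1"
    by (simp add: W_def V_def inverse_mult_eq_1)
  then have "V = U * (W * V)"
    by (metis mult.assoc mult.left_neutral)
  also have "W * V = (1 - fps_X) * V + fps_const (r * r) * fps_X ^ 2 * (V * inverse V)"
    by (simp add: W_def algebra_simps)
  also have "\<dots> = (1 - fps_X) * V + fps_const (r * r) * fps_X ^ 2"
    by (simp add: V)
  finally have "V = U * ((1 - fps_X) * V + fps_const (r * r) * fps_X ^ 2)" .
  then have U: "U = V + fps_const (1 - r) * (fps_X * U) + fps_const (r - r * r) * (fps_X ^ 2 * U)"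
    by (simp add: V_def algebra_simps power2_eq_square flip: fps_const_sub)
  show "U $ 0 = 1" by (subst U) (simp add: V_def)
  then show "U $ 1 = 1" by (subst U) (simp add: V_def fps_X_power_mult_nth)
  show "U $ (m + 2) = (1 - r) * U $ (m + 1) + (r - r * r) * U $ m"
    by (subst U) (simp add: V_def fps_X_power_mult_nth)
qed

text \<open>This supplies the 1 in the complementary probability
  \<open>1 - avoid x y n\<close>.\<close>

lemma fps_nth_inverse_1_minus_X: "(1 / (1 - fps_X) :: 'a :: field fps) $ n = 1"
proof -
  define U where "U = (1 / (1 - fps_X) :: 'a fps)"
  have "U * (1 - fps_X) = 1"
    unfolding U_def by (subst fps_divide_unit) (simp_all add: inverse_mult_eq_1)
  then have U: "U = 1 + fps_X * U"
    by (simp add: algebra_simps)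
  have "U $ n = 1"
  proof (induction n)
    case 0
    show ?case by (subst U) simp
  next
    case (Suc n)
    then show ?case by (subst U) simp
  qed
  then show ?thesis by (simp add: U_def)
qed

section \<open>Avoidance probabilities as coefficients\<close>

context random_word
begin

lemma avoid_distinct_eq_fps_nth:
  assumes "x \<noteq> y"
    and "\<And>k. k \<in> {1..n} \<Longrightarrow> prob {\<omega> \<in> space M. X k \<omega> = x} = a"
    and "\<And>k. k \<in> {1..n} \<Longrightarrow> prob {\<omega> \<in> space M. X k \<omega> = y} = b"
    and "m \<le> n"
  shows "avoid x y m = (1 / (1 - fps_X + fps_const (a * b) * fps_X ^ 2)) $ m"
  using \<open>m \<le> n\<close>
proof (induction m rule: induct_nat_012)
  case (ge2 m)
  then show ?case
    using fps_nth_inverse_quadratic(3)[of "a * b" m]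
    by (simp add: avoid_Suc_Suc avoid_end_distinct assms)
qed (use fps_nth_inverse_quadratic(1,2)[of "a * b"] in \<open>simp_all add: avoid_less_2\<close>)

lemma avoid_same_eq_fps_nth:
  assumes a: "\<And>k. k \<in> {1..n} \<Longrightarrow> prob {\<omega> \<in> space M. X k \<omega> = x} = a" and "m \<le> n"
  shows "avoid x x m =
    (1 / (1 - fps_X + fps_const (a * a) * fps_X ^ 2 / (1 + fps_const a * fps_X))) $ m"
  using \<open>m \<le> n\<close>
proof (induction m rule: induct_nat_012)
  case (ge2 m)
  note U = fps_nth_inverse_diagonal(3)[of a m]
  show ?case
  proof (cases m)
    \<comment> \<open>The recurrence for \<open>avoid_end\<close> does not reach index 0, so length
      2 is computed directly from \<open>avoid_end_one\<close>.\<close>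
    case 0
    then show ?thesis
      using ge2 U fps_nth_inverse_diagonal(1,2)[of a]
      by (simp add: avoid_Suc_Suc avoid_less_2 avoid_end_one a algebra_simps numeral_2_eq_2)
  next
    case (Suc l)
    then have "avoid x x (Suc m) = avoid x x m - avoid_end x x m * a"
      using ge2.prems by (simp add: avoid_Suc_Suc a)
    moreover have "avoid_end x x (Suc m) = (avoid x x m - avoid_end x x m) * a"
      using ge2.prems Suc by (simp add: avoid_end_same a)
    moreover have "avoid x x (Suc (Suc m)) = avoid x x (Suc m) - avoid_end x x (Suc m) * a"
      using ge2.prems by (simp add: avoid_Suc_Suc a)
    \<comment> \<open>The first relation expresses \<open>avoid_end x x m * a\<close> by values of
      \<open>avoid\<close>; substituting it into the other two eliminates \<open>avoid_end\<close>
      without dividing by \<open>a\<close>.\<close>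
    ultimately have "avoid x x (Suc (Suc m)) = (1 - a) * avoid x x (Suc m) + (a - a * a) * avoid x x m"
      by algebra
    then show ?thesis
      using ge2 U by simp
  qed
qed (use fps_nth_inverse_diagonal(1,2)[of a] in \<open>simp_all add: avoid_less_2\<close>)

end

section \<open>The null letter 0 and the splitting of the sum over pairs\<close>

lemma (in prob_space) prob_eq_0_of_geometric:
  fixes Y :: "'a \<Rightarrow> nat"
  assumes [measurable]: "Y \<in> M \<rightarrow>\<^sub>M count_space UNIV" and "0 < p" "p < 1"
    and geom: "\<And>i. i \<ge> 1 \<Longrightarrow> prob {\<omega> \<in> space M. Y \<omega> = i} = p * (1 - p) ^ (i - 1)"
  shows "prob {\<omega> \<in> space M. Y \<omega> = 0} = 0"
proof -
  let ?E = "\<lambda>i. {\<omega> \<in> space M. Y \<omega> = i}"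
  have "(\<lambda>i. prob (?E i)) sums prob (\<Union>i. ?E i)"
    by (rule finite_measure_UNION) (auto simp: disjoint_family_on_def)
  also have "(\<Union>i. ?E i) = space M" by auto
  \<comment> \<open>All values together have probability 1. Without value 0 the sum is
    \<open>1 - prob (?E 0)\<close>, and the geometric series evaluates the same sum to 1.\<close>
  finally have "(\<lambda>i. prob (?E (Suc i))) sums (1 - prob (?E 0))"
    using sums_Suc_iff[of "\<lambda>i. prob (?E i)" "1 - prob (?E 0)"] by (simp add: prob_space)
  moreover have "(\<lambda>i. p * (1 - p) ^ i) sums (p * (1 / (1 - (1 - p))))"
    using assms by (intro sums_mult geometric_sums) auto
  ultimately show ?thesis
    using \<open>0 < p\<close> sums_unique2 by (fastforce simp: geom)
qed

theorem theorem1: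
  fixes p q :: real and M :: "nat \<Rightarrow> 'a measure" and \<Gamma> :: "nat \<Rightarrow> nat \<Rightarrow> 'a \<Rightarrow> nat"
  assumes "0 < p" and "p < 1" and "q = 1 - p"
    and "\<And>n. geometric_random_word p n (M n) (\<Gamma> n)"
  shows "\<exists>S T.
    fps_has_sum
      (\<lambda>(i, j). 1 / (1 - fps_X) -
         1 / (1 - fps_X + fps_const (p * q ^ (i - 1) * (p * q ^ (j - 1))) * fps_X ^ 2))
      S (SIGMA i:{1::nat..}. {1::nat..} - {i}) \<and>
    fps_has_sum
      (\<lambda>i. 1 / (1 - fps_X) -
         1 / (1 - fps_X + fps_const (p * q ^ (i - 1) * (p * q ^ (i - 1))) * fps_X ^ 2
                            / (1 + fps_const (p * q ^ (i - 1)) * fps_X)))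
      T {1::nat..} \<and>
    Abs_fps (\<lambda>n. \<integral>\<omega>. real (num_adjacent_pairs n (\<lambda>k. \<Gamma> n k \<omega>)) \<partial>M n) = S + T"
proof -
  define F G where "F = (\<lambda>(i::nat, j::nat). 1 / (1 - fps_X) -
         1 / (1 - fps_X + fps_const (p * q ^ (i - 1) * (p * q ^ (j - 1))) * fps_X ^ 2))"
    and "G = (\<lambda>i::nat. 1 / (1 - fps_X) -
         1 / (1 - fps_X + fps_const (p * q ^ (i - 1) * (p * q ^ (i - 1))) * fps_X ^ 2
                            / (1 + fps_const (p * q ^ (i - 1)) * fps_X)))"
  define A B where "A = (SIGMA i:{1::nat..}. {1::nat..} - {i})" and "B = (\<lambda>i. (i, i)) ` {1::nat..}"
  let ?e = "\<lambda>n. \<integral>\<omega>. real (num_adjacent_pairs n (\<lambda>k. \<Gamma> n k \<omega>)) \<partial>M n"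
  \<comment> \<open>Each length has its own probability space, so the identity is proved one
    coefficient at a time.\<close>
  have key: "\<exists>s t. ((\<lambda>z. F z $ n) has_sum s) A \<and> ((\<lambda>i. G i $ n) has_sum t) {1..} \<and> ?e n = s + t" for n
  proof -
    have word: "geometric_random_word p n (M n) (\<Gamma> n)" by fact
    interpret prob_space "M n"
      using word by (simp add: geometric_random_word_def)
    interpret random_word "M n" n "\<Gamma> n"
      using word by unfold_locales (simp add: geometric_random_word_def)
    have letter: "prob {\<omega> \<in> space (M n). \<Gamma> n k \<omega> = i} = p * q ^ (i - 1)" if "k \<in> {1..n}" "i \<ge> 1" for k i
      using word that \<open>q = 1 - p\<close> by (simp add: geometric_random_word_def)
    have letter_0: "prob {\<omega> \<in> space (M n). \<Gamma> n k \<omega> = 0} = 0" if "k \<in> {1..n}" for k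
      using that letter assms(1-3) by (intro prob_eq_0_of_geometric[where p = p]) auto
    let ?Q = "\<lambda>(x, y). prob {\<omega> \<in> space (M n). (x, y) \<in> adjacent_pairs n (\<lambda>k. \<Gamma> n k \<omega>)}"
    have Q: "(?Q has_sum ?e n) UNIV"
      by (rule expectation_num_adjacent_pairs)
    \<comment> \<open>The sum in \<open>Q\<close> runs over all pairs of naturals. A pair containing
      0 can occur only if some letter is 0, a finite union of null events.\<close>
    have Q_0: "?Q (x, y) = 0" if "x = 0 \<or> y = 0" for x y
    proof -
      have "(\<Union>k\<in>{1..n}. {\<omega> \<in> space (M n). \<Gamma> n k \<omega> = 0}) \<in> null_sets (M n)"
        using letter_0 by (intro null_sets_UN' sets_letter) (auto simp: null_sets_def emeasure_eq_measure)
      then have "prob (\<Union>k\<in>{1..n}. {\<omega> \<in> space (M n). \<Gamma> n k \<omega> = 0}) = 0"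
        by (simp add: measure_eq_0_null_sets)
      moreover have "?Q (x, y) \<le> prob (\<Union>k\<in>{1..n}. {\<omega> \<in> space (M n). \<Gamma> n k \<omega> = 0})"
        unfolding prod.case using that
        by (intro finite_measure_mono sets.finite_UN sets_letter) (auto simp: mem_adjacent_pairs, force+)
      ultimately show ?thesis
        using measure_nonneg[of "M n"] by (simp add: order_antisym)
    qed
    \<comment> \<open>Every pair outside \<open>A\<close> and \<open>B\<close> contains 0, so
      dropping it does not change the sum.\<close>
    have "(?Q has_sum ?e n) (A \<union> B)"
    proof (rule has_sum_cong_neutral[THEN iffD1, OF _ _ _ Q])
      show "?Q z = 0" if "z \<in> UNIV - (A \<union> B)" for z
        using that Q_0[of "fst z" "snd z"] by (cases z) (auto simp: A_def B_def image_iff Suc_le_eq)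
    qed auto
    moreover have "?Q summable_on A" "?Q summable_on B"
      using Q by (auto simp: summable_on_def intro: summable_on_subset_banach[unfolded summable_on_def])
    then obtain s t where s: "(?Q has_sum s) A" and t: "(?Q has_sum t) B"
      by (auto simp: summable_on_def)
    moreover have "A \<inter> B = {}" by (auto simp: A_def B_def)
    ultimately have "?e n = s + t"
      by (meson has_sum_Un_disjoint has_sum_unique)
    moreover have "?Q z = F z $ n" if "z \<in> A" for z
      using that
      by (auto simp: A_def F_def prob_adjacent_pairs fps_nth_inverse_1_minus_X letter
            intro!: avoid_distinct_eq_fps_nth)
    then have "((\<lambda>z. F z $ n) has_sum s) A"
      using s by (simp cong: has_sum_cong)
    moreover have "?Q (i, i) = G i $ n" if "i \<in> {1..}" for i
      using that
      by (auto simp: G_def prob_adjacent_pairs fps_nth_inverse_1_minus_X letter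
            intro!: avoid_same_eq_fps_nth)
    \<comment> \<open>The diagonal \<open>B\<close> is reindexed by \<open>i\<close>, turning its
      sum into the single sum of \<open>G\<close>.\<close>
    then have "((?Q \<circ> (\<lambda>i. (i, i))) has_sum t) {1..} \<longleftrightarrow> ((\<lambda>i. G i $ n) has_sum t) {1..}"
      by (intro has_sum_cong) simp
    then have "((\<lambda>i. G i $ n) has_sum t) {1..}"
      using t unfolding B_def by (subst (asm) has_sum_reindex) (auto simp: inj_on_def)
    ultimately show ?thesis by blast
  qed
  \<comment> \<open>Choosing the two sums for every \<open>n\<close> gives the coefficient sequences
    of the witnesses \<open>S\<close> and \<open>T\<close>.\<close>
  then obtain s t where "\<And>n. ((\<lambda>z. F z $ n) has_sum s n) A"
    and "\<And>n. ((\<lambda>i. G i $ n) has_sum t n) {1..}" and "\<And>n. ?e n = s n + t n"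
    by metis
  then have "fps_has_sum F (Abs_fps s) A \<and> fps_has_sum G (Abs_fps t) {1..} \<and>
      Abs_fps ?e = Abs_fps s + Abs_fps t"
    by (simp add: fps_has_sum_def fps_eq_iff)
  then show ?thesis
    unfolding F_def G_def A_def by blast
qed

end
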